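(* For any pair of integers $n>0$ and $0\le m\le\binom{n}{2}$, there is a threshold graph with $n$ vertices and $m$ edges. If $m\ge n-1$, there is a connected threshold graph with $n$ vertices and $m$ edges.
   Context: Graphs are finite and simple. A threshold graph is a graph that can be constructed from the one-vertex graph by repeatedly applying one of the following two operations: (i) add an isolated vertex, adjacent to no existing vertex; (ii) add a dominating vertex, adjacent to all existing vertices. The one-vertex graph is connected by definition. *)

theory Defs
  imports "Graph_Theory.Pair_Digraph" "Graph_Theory.Digraph_Component"
begin

text \<open>
  As in Graph_Theory, a finite simple graph is a symmetric loopfree digraph without parallel arcs
  (locale \<open>pair_graph\<close>): each undirected edge is the two arcs (u, v) and (v, u). Undirected edges
  are therefore counted as unordered pairs, not as arcs.
\<close>

definition edges :: "'a pair_pre_digraph \<Rightarrow> 'a set set" where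
  "edges G = {{u, v} |u v. (u, v) \<in> parcs G}"

definition add_isolated :: "'a \<Rightarrow> 'a pair_pre_digraph \<Rightarrow> 'a pair_pre_digraph" where
  "add_isolated v G = \<lparr>pverts = insert v (pverts G), parcs = parcs G\<rparr>"

definition add_dominating :: "'a \<Rightarrow> 'a pair_pre_digraph \<Rightarrow> 'a pair_pre_digraph" where
  "add_dominating v G =
    \<lparr>pverts = insert v (pverts G), parcs = parcs G \<union> {v} \<times> pverts G \<union> pverts G \<times> {v}\<rparr>"

inductive threshold_graph :: "'a pair_pre_digraph \<Rightarrow> bool" where
  one_vertex: "threshold_graph \<lparr>pverts = {v}, parcs = {}\<rparr>"
| isolated: "threshold_graph (add_isolated v G)" if "threshold_graph G" "v \<notin> pverts G"
| dominating: "threshold_graph (add_dominating v G)" if "threshold_graph G" "v \<notin> pverts G"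

lemma threshold_graph_imp_pair_graph:
  assumes "threshold_graph G"
  shows "pair_graph G"
proof -
  from assms have "finite (pverts G) \<and> parcs G \<subseteq> pverts G \<times> pverts G \<and> irrefl (parcs G) \<and> sym (parcs G)"
    by induction (auto simp: add_isolated_def add_dominating_def irrefl_def sym_def)
  moreover from this have "finite (parcs G)"
    by (meson finite_SigmaI finite_subset)
  ultimately show ?thesis
    by unfold_locales (auto simp: symmetric_def irrefl_def)
qed

text \<open>
  The library's \<open>connected\<close> requires a nonempty vertex set and allows walks of length 0, so it
  agrees with the convention that the one-vertex graph is connected. Its name is qualified to
  distinguish it from the topological \<open>connected\<close> of Complex_Main.
\<close>

abbreviation connected_graph :: "'a pair_pre_digraph \<Rightarrow> bool" where
  "connected_graph G \<equiv> Digraph_Component.connected (with_proj G)"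

lemma connected_graph_one_vertex: "connected_graph \<lparr>pverts = {v}, parcs = {}\<rparr>"
  by (auto simp: Digraph_Component.connected_def strongly_connected_def mk_symmetric_def
      reachable_def intro: rtrancl_on.intros)

end

theory Submission
  imports Defs
begin

text \<open>
  Adding a dominating vertex to a graph on \<open>n\<close> vertices contributes exactly \<open>n\<close> edges
  (\<open>card_edges_add_dominating\<close>), and adding an isolated one contributes none. Hence a suitable
  graph can be built greedily, by recursion on the number of vertices. To reach \<open>n + 1\<close> vertices
  and \<open>m\<close> edges, where \<open>n \<ge> 1\<close>, make the last vertex dominating if \<open>m \<ge> n\<close>, and isolated
  otherwise. In the first case the remaining graph needs
  \<open>m - n \<le> (n + 1 choose 2) - n = (n choose 2)\<close> edges; in the second it needs
  \<open>m \<le> n - 1 \<le> (n choose 2)\<close> edges, so the recursion always continues within its range.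

  The same construction settles connectedness: \<open>m \<ge> n\<close> is precisely the case where the last vertex
  dominates, and a dominating vertex joins any two vertices by a walk of length at most two
  (\<open>connected_add_dominating\<close>).
\<close>

lemma threshold_graph_finite_pverts: "threshold_graph G \<Longrightarrow> finite (pverts G)"
  by (induction rule: threshold_graph.induct) (auto simp: add_isolated_def add_dominating_def)

lemma threshold_graph_parcs_subset: "threshold_graph G \<Longrightarrow> parcs G \<subseteq> pverts G \<times> pverts G"
  by (induction rule: threshold_graph.induct) (auto simp: add_isolated_def add_dominating_def)

lemma edges_add_isolated: "edges (add_isolated v G) = edges G"
  by (simp add: edges_def add_isolated_def)

lemma edges_add_dominating:
  "edges (add_dominating v G) = edges G \<union> (\<lambda>u. {v, u}) ` pverts G"
  unfolding edges_def add_dominating_def by auto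

text \<open>
  The new edges correspond to the old vertices by \<open>u \<mapsto> {v, u}\<close>, and none of them is an old
  edge because \<open>v\<close> is fresh.
\<close>

lemma card_edges_add_dominating:
  assumes G: "threshold_graph G" and v: "v \<notin> pverts G"
  shows "card (edges (add_dominating v G)) = card (edges G) + card (pverts G)"
proof -
  have fin: "finite (pverts G)"
    using G by (rule threshold_graph_finite_pverts)
  have sub: "edges G \<subseteq> Pow (pverts G)"
    using threshold_graph_parcs_subset[OF G] by (auto simp: edges_def)
  have "finite (edges G)"
    using sub fin by (simp add: finite_subset)
  moreover have "edges G \<inter> (\<lambda>u. {v, u}) ` pverts G = {}"
    using sub v by auto
  moreover have "card ((\<lambda>u. {v, u}) ` pverts G) = card (pverts G)"
    using v by (intro card_image) (auto simp: inj_on_def doubleton_eq_iff)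
  ultimately show ?thesis
    using fin by (simp add: edges_add_dominating card_Un_disjoint)
qed

lemma connected_add_dominating:
  assumes G: "threshold_graph G" and v: "v \<notin> pverts G"
  shows "connected_graph (add_dominating v G)"
proof -
  let ?H = "add_dominating v G"
  have "pair_graph ?H"
    using G v by (intro threshold_graph_imp_pair_graph threshold_graph.dominating)
  then interpret H: pair_graph ?H .
  have to_v: "u \<rightarrow>\<^sup>*\<^bsub>with_proj ?H\<^esub> v" and from_v: "v \<rightarrow>\<^sup>*\<^bsub>with_proj ?H\<^esub> u"
    if "u \<in> pverts ?H" for u
  proof -
    have "u = v \<or> (u, v) \<in> parcs ?H \<and> (v, u) \<in> parcs ?H"
      using that by (auto simp: add_dominating_def)
    then show "u \<rightarrow>\<^sup>*\<^bsub>with_proj ?H\<^esub> v" "v \<rightarrow>\<^sup>*\<^bsub>with_proj ?H\<^esub> u"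
      using that by (auto intro: H.reachable_adjI)
  qed
  show ?thesis
    unfolding Digraph_Component.connected_def
  proof (rule strongly_connectedI)
    show "verts (with_proj (mk_symmetric (with_proj ?H))) \<noteq> {}"
      by (simp add: add_dominating_def)
    show "u \<rightarrow>\<^sup>*\<^bsub>with_proj (mk_symmetric (with_proj ?H))\<^esub> w"
      if "u \<in> verts (with_proj (mk_symmetric (with_proj ?H)))"
        "w \<in> verts (with_proj (mk_symmetric (with_proj ?H)))" for u w
      using that H.reachable_mk_symmetricI[OF H.reachable_trans[OF to_v from_v]] by simp
  qed
qed

lemma pred_le_choose_two: "n - 1 \<le> n choose 2"
  by (cases n) (simp_all add: numeral_2_eq_2)

text \<open>
  The greedy construction. The vertex set is fixed to be an initial segment so that a fresh
  vertex is at hand, and connectedness is part of the claim because both assertions of the theorem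
  are witnessed by the same graph.
\<close>

lemma threshold_graph_with_edges:
  assumes "m \<le> Suc n choose 2"
  shows "\<exists>G. threshold_graph G \<and> pverts G = {..n} \<and> card (edges G) = m
           \<and> (m \<ge> n \<longrightarrow> connected_graph G)"
  using assms
proof (induction n arbitrary: m)
  case 0
  let ?G = "\<lparr>pverts = {0}, parcs = {}\<rparr> :: nat pair_pre_digraph"
  have "threshold_graph ?G" "connected_graph ?G" "pverts ?G = {..0}" "card (edges ?G) = m"
    using 0 by (auto simp: threshold_graph.one_vertex connected_graph_one_vertex edges_def
        numeral_2_eq_2)
  then show ?case
    by blast
next
  case (Suc n)
  have choose: "Suc (Suc n) choose 2 = Suc n + (Suc n choose 2)"
    by (simp add: numeral_2_eq_2)
  show ?case
  proof (cases "m \<ge> Suc n")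
    case True
    have "m - Suc n \<le> Suc n choose 2"
      using Suc.prems choose by simp
    then obtain G where G: "threshold_graph G" "pverts G = {..n}" "card (edges G) = m - Suc n"
      using Suc.IH by blast
    let ?H = "add_dominating (Suc n) G"
    have new: "Suc n \<notin> pverts G"
      using G(2) by simp
    have "threshold_graph ?H"
      using G(1) new by (rule threshold_graph.dominating)
    moreover have "connected_graph ?H"
      using G(1) new by (rule connected_add_dominating)
    moreover have "pverts ?H = {..Suc n}"
      using G(2) by (simp add: add_dominating_def atMost_Suc)
    moreover have "card (edges ?H) = m"
      using card_edges_add_dominating[OF G(1) new] G(2,3) True by simp
    ultimately show ?thesis
      by blast
  next
    case False
    then have "m \<le> Suc n choose 2"
      using pred_le_choose_two[of "Suc n"] by linarith
    then obtain G where G: "threshold_graph G" "pverts G = {..n}" "card (edges G) = m"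
      using Suc.IH by blast
    let ?H = "add_isolated (Suc n) G"
    have "threshold_graph ?H"
      using G(1,2) by (intro threshold_graph.isolated) simp_all
    moreover have "pverts ?H = {..Suc n}"
      using G(2) by (simp add: add_isolated_def atMost_Suc)
    moreover have "card (edges ?H) = m"
      using G(3) by (simp add: edges_add_isolated)
    ultimately show ?thesis
      using False by blast
  qed
qed

theorem lemma2p5:
  fixes n m :: nat
  assumes "n > 0" and "m \<le> n choose 2"
  shows "(\<exists>G :: nat pair_pre_digraph.
            threshold_graph G \<and> card (pverts G) = n \<and> card (edges G) = m) \<and>
         (m \<ge> n - 1 \<longrightarrow>
           (\<exists>G :: nat pair_pre_digraph.
              threshold_graph G \<and> connected_graph G \<and> card (pverts G) = n \<and> card (edges G) = m))"
proof -
  obtain k where k: "n = Suc k"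
    using assms(1) gr0_implies_Suc by blast
  obtain G :: "nat pair_pre_digraph" where "threshold_graph G" "pverts G = {..k}"
    "card (edges G) = m" "m \<ge> k \<longrightarrow> connected_graph G"
    using threshold_graph_with_edges assms(2) k by blast
  then show ?thesis
    using k by auto
qed

end
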